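(* Let $(X,b)$ be a connected graph and let $m:X\to(0,\infty)$ be such that $\mathrm{vol}_m(X)=\sum_{x\in X}m(x)<\infty$. Then $$\lambda_1^N(X,b,m)\ \ge\ \frac{4}{\mathrm{diam}_r(X)\cdot\mathrm{vol}_m(X)},$$ and the estimate is optimal, in the sense that for the given graph $(X,b)$ $$\inf\bigl\{\lambda_1^N(X,b,m')\,\mathrm{vol}_{m'}(X)\ \bigm|\ m':X\to(0,\infty),\ \mathrm{vol}_{m'}(X)<\infty\bigr\}=\frac{4}{\mathrm{diam}_r(X)} .$$
   Context: A graph $(X,b)$ consists of a non-empty set $X$ and a symmetric function $b:X\times X\to[0,\infty)$ with $b(x,x)=0$ for all $x$ (no local finiteness or summability of $b$ is assumed). It is connected if for any $x,y\in X$ there is a finite sequence $x=x_0,\dots,x_k=y$ with $b(x_l,x_{l+1})>0$ for $l=0,\dots,k-1$. The energy is $\mathcal{E}(f)=\frac12\sum_{x,y\in X}b(x,y)(f(x)-f(y))^2\in[0,\infty]$ for $f:X\to\mathbb{R}$. Define $$\rho(x,y)=\sup\{f(x)-f(y)\mid f:X\to\mathbb{R},\ \mathcal{E}(f)\le1\},\qquad r(x,y)=\rho(x,y)^2,$$ and $\mathrm{diam}_r(X)=\sup\{r(x,y)\mid x,y\in X\}\in[0,\infty]$. For $m:X\to(0,\infty)$ with $\mathrm{vol}_m(X)=\sum_x m(x)<\infty$, let $\ell^2(X,m)=\{f:X\to\mathbb{R}\mid\sum_x f(x)^2m(x)<\infty\}$ with inner product $\langle f,g\rangle=\sum_x f(x)g(x)m(x)$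 and norm $\|f\|=\sqrt{\langle f,f\rangle}$, and $$\lambda_1^N(X,b,m)=\inf\{\mathcal{E}(f)\mid f\in\ell^2(X,m),\ \mathcal{E}(f)<\infty,\ \langle f,1\rangle=0,\ \|f\|=1\},$$ with $\inf\emptyset=\infty$. Conventions: $4/\infty=0$ and $4/0=\infty$. *)

theory Defs
  imports "HOL-Analysis.Analysis"
begin

text \<open>
  The vertex set is a carrier set \<open>X\<close>. Functions on \<open>X\<close> are represented by total functions, and
  every notion below depends only on their values on \<open>X\<close>. Quantities that may be infinite take
  values in \<open>ennreal\<close>, where infinite sums always exist, \<open>4 / 0 = \<infinity>\<close>, \<open>4 / \<infinity> = 0\<close> and
  \<open>Inf {} = \<infinity>\<close>.
\<close>

locale weighted_graph =
  fixes X :: "'a set" and b :: "'a \<Rightarrow> 'a \<Rightarrow> real"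
  assumes nonempty: "X \<noteq> {}"
    and nonneg: "\<And>x y. x \<in> X \<Longrightarrow> y \<in> X \<Longrightarrow> 0 \<le> b x y"
    and symmetric: "\<And>x y. x \<in> X \<Longrightarrow> y \<in> X \<Longrightarrow> b x y = b y x"
    and no_loops: "\<And>x. x \<in> X \<Longrightarrow> b x x = 0"

definition graph_path :: "'a set \<Rightarrow> ('a \<Rightarrow> 'a \<Rightarrow> real) \<Rightarrow> (nat \<Rightarrow> 'a) \<Rightarrow> nat \<Rightarrow> bool" where
  "graph_path X b p k \<longleftrightarrow> (\<forall>l\<le>k. p l \<in> X) \<and> (\<forall>l<k. 0 < b (p l) (p (Suc l)))"

locale connected_weighted_graph = weighted_graph +
  assumes connected:
    "\<And>x y. x \<in> X \<Longrightarrow> y \<in> X \<Longrightarrow> \<exists>p k. graph_path X b p k \<and> p 0 = x \<and> p k = y"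

definition energy :: "'a set \<Rightarrow> ('a \<Rightarrow> 'a \<Rightarrow> real) \<Rightarrow> ('a \<Rightarrow> real) \<Rightarrow> ennreal" where
  "energy X b f = (1 / 2) * (\<Sum>\<^sub>\<infinity>(x, y)\<in>X \<times> X. ennreal (b x y * (f x - f y)\<^sup>2))"

text \<open>
  The coercion \<open>ennreal\<close> sends negative reals to \<open>0\<close>. This does not change the supremum below,
  because \<open>f = 0\<close> is admissible and contributes the value \<open>0\<close>.
\<close>

definition rho :: "'a set \<Rightarrow> ('a \<Rightarrow> 'a \<Rightarrow> real) \<Rightarrow> 'a \<Rightarrow> 'a \<Rightarrow> ennreal" where
  "rho X b x y = Sup {ennreal (f x - f y) |f. energy X b f \<le> 1}"

definition resistance :: "'a set \<Rightarrow> ('a \<Rightarrow> 'a \<Rightarrow> real) \<Rightarrow> 'a \<Rightarrow> 'a \<Rightarrow> ennreal" where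
  "resistance X b x y = (rho X b x y)\<^sup>2"

definition diam_r :: "'a set \<Rightarrow> ('a \<Rightarrow> 'a \<Rightarrow> real) \<Rightarrow> ennreal" where
  "diam_r X b = Sup {resistance X b x y |x y. x \<in> X \<and> y \<in> X}"

definition vol :: "'a set \<Rightarrow> ('a \<Rightarrow> real) \<Rightarrow> ennreal" where
  "vol X m = (\<Sum>\<^sub>\<infinity>x\<in>X. ennreal (m x))"

definition ell2 :: "'a set \<Rightarrow> ('a \<Rightarrow> real) \<Rightarrow> ('a \<Rightarrow> real) set" where
  "ell2 X m = {f. (\<lambda>x. (f x)\<^sup>2 * m x) summable_on X}"

definition ell2_inner :: "'a set \<Rightarrow> ('a \<Rightarrow> real) \<Rightarrow> ('a \<Rightarrow> real) \<Rightarrow> ('a \<Rightarrow> real) \<Rightarrow> real" where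
  "ell2_inner X m f g = (\<Sum>\<^sub>\<infinity>x\<in>X. f x * g x * m x)"

definition ell2_norm :: "'a set \<Rightarrow> ('a \<Rightarrow> real) \<Rightarrow> ('a \<Rightarrow> real) \<Rightarrow> real" where
  "ell2_norm X m f = sqrt (ell2_inner X m f f)"

definition neumann_lambda1 ::
    "'a set \<Rightarrow> ('a \<Rightarrow> 'a \<Rightarrow> real) \<Rightarrow> ('a \<Rightarrow> real) \<Rightarrow> ennreal" where
  "neumann_lambda1 X b m =
    Inf {energy X b f |f. f \<in> ell2 X m \<and> energy X b f < \<infinity> \<and>
      ell2_inner X m f (\<lambda>_. 1) = 0 \<and> ell2_norm X m f = 1}"

end

theory Submission imports Defs begin

text \<open>
  \<^bold>\<open>Lower bound.\<close> The resistance turns an energy bound into an oscillation bound: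
  $(f(x) - f(y))^2 \leq r(x,y)\, \mathcal{E}(f)$, so a function \<open>f\<close> of energy \<open>e\<close> oscillates by at most
  \<open>sqrt (D * e)\<close>, where \<open>D\<close> is the resistance diameter (\<open>oscillation_le_resistance\<close>). By
  Popoviciu's inequality, a function of mean zero with values in an interval of length \<open>l\<close>
  has variance at most \<open>l\<^sup>2 / 4\<close>, that is, squared norm at most \<open>l\<^sup>2 / 4\<close> times
  the volume (\<open>popoviciu\<close>). For a function of norm \<open>1\<close> this gives \<open>1 \<le> D * e * vol / 4\<close>.

  \<^bold>\<open>Optimality.\<close> Popoviciu's inequality is sharp for two equal masses at the two ends of the
  interval. Hence take any \<open>f\<close> of energy at most \<open>1\<close> and vertices with \<open>f y < f x\<close>, and let the
  measure be \<open>1\<close> at \<open>x\<close> and \<open>y\<close> and a small multiple of the given finite measure elsewhere; its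
  volume is close to \<open>2\<close>. Centring \<open>f\<close> leaves a squared norm of at least
  \<open>(f x - f y)\<^sup>2 / 2\<close>, already from the two heavy vertices, so
  \<open>\<lambda>\<^sub>1 * vol\<close> is at most \<open>4 / (f x - f y)\<^sup>2\<close> up to an arbitrarily small error
  (\<open>Inf_neumann_lambda1_vol_le\<close>). The supremum over \<open>f\<close>, \<open>x\<close> and \<open>y\<close> turns
  \<open>(f x - f y)\<^sup>2\<close> into the resistance diameter.
\<close>

section \<open>Transformations of the energy\<close>

text \<open>
  Multiplication on \<open>ennreal\<close> is not continuous at \<open>(0, \<infinity>)\<close>, so scalars are pulled out through
  the representation of the sum as a supremum of finite sums.
\<close>

lemma infsum_cmult_right_ennreal:
  fixes f :: "'a \<Rightarrow> ennreal"
  shows "(\<Sum>\<^sub>\<infinity>x\<in>A. c * f x) = c * (\<Sum>\<^sub>\<infinity>x\<in>A. f x)"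
proof -
  have "(\<Sum>\<^sub>\<infinity>x\<in>A. c * f x) = (SUP F\<in>{F. finite F \<and> F \<subseteq> A}. c * sum f F)"
    by (simp add: nonneg_infsum_complete sum_distrib_left)
  also have "\<dots> = c * (\<Sum>\<^sub>\<infinity>x\<in>A. f x)"
    by (simp add: nonneg_infsum_complete SUP_mult_left_ennreal)
  finally show ?thesis .
qed

lemma energy_affine:
  "energy X b (\<lambda>z. s * (f z - c)) = ennreal (s\<^sup>2) * energy X b f"
proof -
  have eq: "ennreal (b x y * (s * (f x - c) - s * (f y - c))\<^sup>2)
      = ennreal (s\<^sup>2) * ennreal (b x y * (f x - f y)\<^sup>2)" for x y
    by (simp add: ennreal_mult'[symmetric] algebra_simps power2_eq_square)
  have "(\<Sum>\<^sub>\<infinity>(x, y)\<in>X \<times> X. ennreal (b x y * (s * (f x - c) - s * (f y - c))\<^sup>2))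
      = ennreal (s\<^sup>2) * (\<Sum>\<^sub>\<infinity>(x, y)\<in>X \<times> X. ennreal (b x y * (f x - f y)\<^sup>2))"
    unfolding eq infsum_cmult_right_ennreal[symmetric]
    by (intro infsum_cong) auto
  then show ?thesis
    unfolding energy_def by (simp add: mult.left_commute)
qed

text \<open>
  This is the Markov property of the energy. It allows a function of finite energy to be truncated
  to a bounded one, which is square integrable for every finite measure.
\<close>

lemma energy_contraction:
  assumes "\<And>x y. x \<in> X \<Longrightarrow> y \<in> X \<Longrightarrow> 0 \<le> b x y"
    and "\<And>x y. x \<in> X \<Longrightarrow> y \<in> X \<Longrightarrow> \<bar>g x - g y\<bar> \<le> \<bar>f x - f y\<bar>"
  shows "energy X b g \<le> energy X b f"
  unfolding energy_def
  by (intro mult_left_mono infsum_mono nonneg_summable_on_complete)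
    (auto intro!: ennreal_leI mult_left_mono assms(1) simp: abs_le_square_iff[symmetric] assms(2))

section \<open>Resistance and oscillation\<close>

text \<open>
  Rescaling \<open>f\<close> to energy at most \<open>1\<close> makes it admissible in the supremum that defines \<open>rho\<close>.
  Dividing by \<open>sqrt e'\<close> with \<open>e < e'\<close>, and letting \<open>e'\<close> decrease to \<open>e\<close>, also covers
  functions of energy zero.
\<close>

lemma oscillation_le_resistance:
  assumes "resistance X b x y \<le> ennreal d" "0 \<le> d"
    and "energy X b f \<le> ennreal e" "0 \<le> e"
  shows "(f x - f y)\<^sup>2 \<le> d * e"
proof -
  have scaled: "(g x - g y)\<^sup>2 \<le> d" if g: "energy X b g \<le> 1" "g y \<le> g x" for g
  proof -
    have "ennreal (g x - g y) \<le> rho X b x y"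
      unfolding rho_def by (rule Sup_upper) (use g in auto)
    then have "(ennreal (g x - g y))\<^sup>2 \<le> ennreal d"
      using assms(1) unfolding resistance_def by (meson order_trans power_mono zero_le)
    then show ?thesis
      using g(2) assms(2) by (simp add: ennreal_power)
  qed
  have strict: "(f x - f y)\<^sup>2 \<le> d * e'" if "e < e'" for e'
  proof -
    \<comment> \<open>The sign makes the difference nonnegative, so that \<open>ennreal\<close> does not truncate it.\<close>
    define s where "s = (if f y \<le> f x then 1 else -1) / sqrt e'"
    have e': "0 < e'" using that assms(4) by simp
    have s2: "s\<^sup>2 = 1 / e'"
      using e' by (auto simp: s_def power_divide)
    have "energy X b (\<lambda>z. s * (f z - 0)) \<le> ennreal (1 / e') * ennreal e'"
      unfolding energy_affine s2
      by (intro mult_left_mono order_trans[OF assms(3)] ennreal_leI) (use that in auto)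
    also have "\<dots> = 1"
      using e' by (simp add: ennreal_mult'[symmetric])
    finally have "(s * (f x - 0) - s * (f y - 0))\<^sup>2 \<le> d"
      by (intro scaled) (use e' in \<open>auto simp: s_def divide_simps\<close>)
    moreover have "(s * (f x - 0) - s * (f y - 0))\<^sup>2 = (f x - f y)\<^sup>2 / e'"
      using s2 by (simp add: right_diff_distrib[symmetric] power_mult_distrib)
    ultimately show ?thesis
      using e' by (simp add: pos_divide_le_eq)
  qed
  have "((\<lambda>e'. d * e') \<longlongrightarrow> d * e) (at_right e)"
    by (intro tendsto_intros)
  moreover have "\<forall>\<^sub>F e' in at_right e. (f x - f y)\<^sup>2 \<le> d * e'"
    unfolding eventually_at_right_field by (intro exI[of _ "e + 1"]) (auto intro: strict)
  ultimately show ?thesis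
    by (intro tendsto_lowerbound) auto
qed

text \<open>
  With the conventions \<open>c / 0 = \<infinity>\<close> and \<open>c / \<infinity> = 0\<close> the equivalence has no exceptional
  values of \<open>a\<close> and \<open>b\<close>. It is symmetric in \<open>a\<close> and \<open>b\<close>, hence \<open>a \<le> c / b\<close> and \<open>b \<le> c / a\<close>
  are equivalent.
\<close>

lemma le_divide_ennreal_iff:
  fixes a b c :: ennreal
  assumes "c \<noteq> 0" "c \<noteq> \<infinity>"
  shows "a \<le> c / b \<longleftrightarrow> b * a \<le> c"
proof (cases b)
  case top
  then show ?thesis using assms by (auto simp: ennreal_top_mult top_unique)
next
  case (real r)
  show ?thesis
  proof (cases "b = 0")
    case True
    then show ?thesis using assms by simp
  next
    case False
    then have "c < a * b \<longleftrightarrow> c / b < a"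
      using real(2) by (intro divide_less_ennreal[symmetric]) auto
    then show ?thesis by (simp add: not_less[symmetric] mult.commute)
  qed
qed

text \<open>
  The square of a supremum is the double supremum of the products \<open>a * b'\<close>, and each product is at
  most the square of its larger factor.
\<close>

lemma square_Sup_le_ennreal:
  fixes S :: "ennreal set"
  assumes "\<And>a. a \<in> S \<Longrightarrow> a\<^sup>2 \<le> c"
  shows "(Sup S)\<^sup>2 \<le> c"
proof -
  have "a * b' \<le> c" if "a \<in> S" "b' \<in> S" for a b'
  proof -
    have "a * b' \<le> (max a b')\<^sup>2"
      unfolding power2_eq_square by (intro mult_mono) auto
    also have "\<dots> \<le> c"
      using that assms by (auto simp: max_def)
    finally show ?thesis .
  qed
  then have "(SUP a\<in>S. (SUP b'\<in>S. a * b')) \<le> c"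
    by (intro SUP_least)
  also have "(SUP a\<in>S. (SUP b'\<in>S. a * b')) = (Sup S)\<^sup>2"
    using SUP_mult_left_ennreal[of _ "\<lambda>x. x" S] SUP_mult_right_ennreal[of "\<lambda>x. x" S]
    by (simp add: power2_eq_square mult.commute)
  finally show ?thesis .
qed

lemma diam_r_le:
  assumes "\<And>x y f. x \<in> X \<Longrightarrow> y \<in> X \<Longrightarrow> energy X b f \<le> 1 \<Longrightarrow> f y < f x \<Longrightarrow>
      ennreal ((f x - f y)\<^sup>2) \<le> c"
  shows "diam_r X b \<le> c"
proof -
  have "(ennreal (f x - f y))\<^sup>2 \<le> c" if "x \<in> X" "y \<in> X" "energy X b f \<le> 1" for x y f
    using assms[OF that] by (cases "f y < f x") (auto simp: ennreal_power ennreal_neg)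
  then show ?thesis
    unfolding diam_r_def resistance_def rho_def
    by (auto intro!: Sup_least square_Sup_le_ennreal)
qed

section \<open>Finite measures\<close>

lemma vol_finite:
  assumes "\<And>x. x \<in> X \<Longrightarrow> 0 \<le> m x" "vol X m < \<infinity>"
  shows "m summable_on X" "vol X m = ennreal (\<Sum>\<^sub>\<infinity>x\<in>X. m x)"
proof -
  have vol: "vol X m = (SUP F\<in>{F. finite F \<and> F \<subseteq> X}. \<Sum>x\<in>F. ennreal (m x))"
    unfolding vol_def by (simp add: nonneg_infsum_complete)
  have eq: "(\<Sum>x\<in>F. ennreal (m x)) = ennreal (sum m F)" if "F \<subseteq> X" for F
    using that assms(1) by (subst sum_ennreal) auto
  obtain v where v: "0 \<le> v" "vol X m = ennreal v"
    using assms(2) by (cases "vol X m") auto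
  have "sum m F \<le> v" if "finite F" "F \<subseteq> X" for F
  proof -
    have "ennreal (sum m F) \<le> ennreal v"
      unfolding v(2)[symmetric] vol using that by (auto simp: eq[symmetric] intro!: SUP_upper)
    then show ?thesis using v(1) by simp
  qed
  then show summable: "m summable_on X"
    using assms(1) by (intro nonneg_bdd_above_summable_on) (auto intro!: bdd_aboveI)
  show "vol X m = ennreal (\<Sum>\<^sub>\<infinity>x\<in>X. m x)"
    unfolding vol using summable assms(1)
    by (subst infsum_nonneg_is_SUPREMUM_ennreal) (auto intro!: SUP_cong simp: eq)
qed

lemma vol_pos:
  assumes "X \<noteq> {}" "\<And>x. x \<in> X \<Longrightarrow> 0 < m x"
  shows "0 < vol X m"
proof -
  obtain x where x: "x \<in> X" using assms(1) by auto
  have "0 < ennreal (m x)" using assms(2)[OF x] by simp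
  also have "\<dots> = (\<Sum>\<^sub>\<infinity>y\<in>{x}. ennreal (m y))" by simp
  also have "\<dots> \<le> vol X m"
    unfolding vol_def by (intro infsum_mono_neutral nonneg_summable_on_complete) (use x in auto)
  finally show ?thesis .
qed

lemma bounded_mult_summable_on:
  fixes f m :: "'a \<Rightarrow> real"
  assumes "m summable_on X" "\<And>x. x \<in> X \<Longrightarrow> 0 \<le> m x" "\<And>x. x \<in> X \<Longrightarrow> \<bar>f x\<bar> \<le> B"
  shows "(\<lambda>x. f x * m x) summable_on X"
proof -
  have "(\<lambda>x. norm (B * m x)) summable_on X"
    using summable_on_cmult_right[OF assms(1), of "\<bar>B\<bar>"] assms(2)
    by (simp add: abs_mult cong: summable_on_cong)
  moreover have "norm (f x * m x) \<le> norm (B * m x)" if "x \<in> X" for x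
    using assms(2)[OF that] assms(3)[OF that] by (auto simp: abs_mult intro!: mult_right_mono)
  ultimately show ?thesis
    by (rule abs_summable_summable[OF Infinite_Sum.abs_summable_on_comparison_test])
qed

text \<open>
  The values of \<open>f\<close> lie in an interval of length \<open>sqrt K\<close> with midpoint \<open>\<mu>\<close>, so
  \<open>(f x - \<mu>)\<^sup>2 \<le> K / 4\<close>. Integrated, this bounds the squared norm, because the mixed term
  vanishes for mean zero and the term with \<open>\<mu>\<^sup>2\<close> only helps.
\<close>

lemma popoviciu:
  fixes f m :: "'a \<Rightarrow> real"
  assumes "X \<noteq> {}"
    and m: "m summable_on X" "\<And>x. x \<in> X \<Longrightarrow> 0 \<le> m x"
    and osc: "\<And>x y. x \<in> X \<Longrightarrow> y \<in> X \<Longrightarrow> (f x - f y)\<^sup>2 \<le> K"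
    and mean: "(\<Sum>\<^sub>\<infinity>x\<in>X. f x * m x) = 0"
    and sq: "(\<lambda>x. (f x)\<^sup>2 * m x) summable_on X"
  shows "(\<Sum>\<^sub>\<infinity>x\<in>X. (f x)\<^sup>2 * m x) \<le> K / 4 * (\<Sum>\<^sub>\<infinity>x\<in>X. m x)"
proof -
  define a where "a = (INF x\<in>X. f x)"
  define \<mu> where "\<mu> = a + sqrt K / 2"
  obtain x0 where x0: "x0 \<in> X" using assms(1) by auto
  have K: "0 \<le> K" using osc[OF x0 x0] by simp
  have osc': "f x - sqrt K \<le> f y" if "x \<in> X" "y \<in> X" for x y
    using real_le_rsqrt[OF osc[OF that]] by simp
  have bdd: "bdd_below (f ` X)"
    using osc'[OF x0] by (auto intro!: bdd_belowI)
  have range: "a \<le> f x" "f x \<le> a + sqrt K" if "x \<in> X" for x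
  proof -
    show "a \<le> f x" unfolding a_def by (rule cINF_lower[OF bdd that])
    have "f x - sqrt K \<le> a"
      unfolding a_def using assms(1) osc'[OF that] by (intro cINF_greatest)
    then show "f x \<le> a + sqrt K" by simp
  qed
  have fm: "(\<lambda>x. f x * m x) summable_on X"
    by (rule bounded_mult_summable_on[OF m, where B = "\<bar>a\<bar> + sqrt K"])
      (use range K real_sqrt_ge_zero[OF K] in \<open>fastforce simp: abs_le_iff\<close>)+
  have pointwise: "(f x)\<^sup>2 * m x \<le> (K / 4 - \<mu>\<^sup>2) * m x + 2 * \<mu> * (f x * m x)" if "x \<in> X" for x
  proof -
    have "\<bar>f x - \<mu>\<bar> \<le> sqrt K / 2"
      using range[OF that] by (simp add: \<mu>_def abs_le_iff field_simps)
    then have "(f x - \<mu>)\<^sup>2 \<le> (sqrt K / 2)\<^sup>2"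
      by (simp add: abs_le_square_iff[symmetric] K)
    then have "(f x)\<^sup>2 \<le> K / 4 - \<mu>\<^sup>2 + 2 * \<mu> * f x"
      using K by (simp add: power_divide power2_diff field_simps)
    from mult_right_mono[OF this m(2)[OF that]] show ?thesis
      by (simp add: algebra_simps)
  qed
  have "(\<Sum>\<^sub>\<infinity>x\<in>X. (f x)\<^sup>2 * m x)
      \<le> (\<Sum>\<^sub>\<infinity>x\<in>X. (K / 4 - \<mu>\<^sup>2) * m x + 2 * \<mu> * (f x * m x))"
    by (intro infsum_mono sq summable_on_add summable_on_cmult_right m(1) fm pointwise)
  also have "\<dots> = (K / 4 - \<mu>\<^sup>2) * (\<Sum>\<^sub>\<infinity>x\<in>X. m x) + 2 * \<mu> * (\<Sum>\<^sub>\<infinity>x\<in>X. f x * m x)"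
    by (subst infsum_add) (auto intro!: summable_on_cmult_right m(1) fm simp: infsum_cmult_right')
  also have "\<dots> \<le> K / 4 * (\<Sum>\<^sub>\<infinity>x\<in>X. m x)"
    unfolding mean using infsum_nonneg[of X m] m(2) by (simp add: algebra_simps)
  finally show ?thesis .
qed

section \<open>The lower bound\<close>

lemma neumann_lambda1_ge:
  assumes "X \<noteq> {}" "\<And>x. x \<in> X \<Longrightarrow> 0 < m x" "vol X m < \<infinity>"
  shows "4 / (diam_r X b * vol X m) \<le> neumann_lambda1 X b m"
  unfolding neumann_lambda1_def
proof (rule Inf_greatest, clarify)
  fix f
  assume f: "f \<in> ell2 X m" "energy X b f < \<infinity>"
    "ell2_inner X m f (\<lambda>_. 1) = 0" "ell2_norm X m f = 1"
  have nonneg: "0 \<le> m x" if "x \<in> X" for x using assms(2)[OF that] by simp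
  define v where "v = (\<Sum>\<^sub>\<infinity>x\<in>X. m x)"
  have vol: "vol X m = ennreal v" and summable: "m summable_on X"
    using vol_finite[of X m] nonneg assms(3) by (auto simp: v_def)
  have v: "0 < v" using vol_pos[of X m] assms(1,2) vol by simp
  obtain e where e: "0 \<le> e" "energy X b f = ennreal e"
    using f(2) by (cases "energy X b f") auto
  show "4 / (diam_r X b * vol X m) \<le> energy X b f"
  proof (cases "diam_r X b")
    case top
    then show ?thesis using v vol by (simp add: ennreal_top_mult)
  next
    case (real d)
    have "resistance X b x y \<le> ennreal d" if "x \<in> X" "y \<in> X" for x y
      unfolding real(2)[symmetric] diam_r_def using that by (auto intro: Sup_upper)
    then have "(f x - f y)\<^sup>2 \<le> d * e" if "x \<in> X" "y \<in> X" for x y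
      using oscillation_le_resistance real(1) e that by (metis order_refl)
    then have "(\<Sum>\<^sub>\<infinity>x\<in>X. (f x)\<^sup>2 * m x) \<le> d * e / 4 * v"
      using f(1,3) unfolding v_def
      by (intro popoviciu assms(1) summable nonneg) (auto simp: ell2_def ell2_inner_def)
    moreover have "(\<Sum>\<^sub>\<infinity>x\<in>X. (f x)\<^sup>2 * m x) = 1"
      using f(4) by (simp add: ell2_norm_def ell2_inner_def power2_eq_square)
    ultimately have le: "4 \<le> d * v * e" by (simp add: algebra_simps)
    then have "d \<noteq> 0" by auto
    then have d: "0 < d" using real(1) by simp
    have "4 / (diam_r X b * vol X m) = ennreal (4 / (d * v))"
      using d v by (simp add: real(2) vol ennreal_mult'[symmetric] divide_ennreal[symmetric])
    also have "\<dots> \<le> ennreal e"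
      using le d v by (intro ennreal_leI) (simp add: divide_simps mult.commute)
    finally show ?thesis by (simp add: e)
  qed
qed

section \<open>Optimality\<close>

text \<open>
  The test function is \<open>f\<close> minus its mean \<open>c\<close>, normalised. Whatever the value of \<open>c\<close>, the two unit
  masses contribute at least \<open>(f x - f y)\<^sup>2 / 2\<close> to its squared norm, so neither the mean nor
  the rest of the norm has to be computed.
\<close>

lemma neumann_lambda1_le_test_function:
  assumes "X \<noteq> {}" "\<And>x. x \<in> X \<Longrightarrow> 0 < m x" "vol X m < \<infinity>"
    and bounded: "\<And>z. z \<in> X \<Longrightarrow> \<bar>f z\<bar> \<le> B"
    and "energy X b f \<le> 1" "x \<in> X" "y \<in> X" "m x = 1" "m y = 1" "f y < f x"
  shows "neumann_lambda1 X b m \<le> ennreal (2 / (f x - f y)\<^sup>2)"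
proof -
  have nonneg: "0 \<le> m x" if "x \<in> X" for x using assms(2)[OF that] by simp
  define v where "v = (\<Sum>\<^sub>\<infinity>x\<in>X. m x)"
  have vol: "vol X m = ennreal v" and summable: "m summable_on X"
    using vol_finite[of X m] nonneg assms(3) by (auto simp: v_def)
  have v: "0 < v" using vol_pos[of X m] assms(1,2) vol by simp
  define c where "c = (\<Sum>\<^sub>\<infinity>z\<in>X. f z * m z) / v"
  define N where "N = (\<Sum>\<^sub>\<infinity>z\<in>X. (f z - c)\<^sup>2 * m z)"
  define g where "g = (\<lambda>z. (1 / sqrt N) * (f z - c))"
  have fm: "(\<lambda>z. f z * m z) summable_on X"
    by (rule bounded_mult_summable_on[OF summable nonneg bounded])
  have dev: "(\<lambda>z. (f z - c)\<^sup>2 * m z) summable_on X"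
  proof (rule bounded_mult_summable_on[OF summable nonneg, where B = "(B + \<bar>c\<bar>)\<^sup>2"])
    fix z assume "z \<in> X"
    then have "\<bar>f z - c\<bar> \<le> \<bar>B + \<bar>c\<bar>\<bar>" using bounded[of z] by linarith
    then show "\<bar>(f z - c)\<^sup>2\<bar> \<le> (B + \<bar>c\<bar>)\<^sup>2" by (simp add: abs_le_square_iff)
  qed
  have "(f x - f y)\<^sup>2 / 2 \<le> (f x - c)\<^sup>2 + (f y - c)\<^sup>2"
    using zero_le_power2[of "(f x - c) + (f y - c)"] by (simp add: power2_eq_square field_simps)
  also have "\<dots> = (\<Sum>z\<in>{x, y}. (f z - c)\<^sup>2 * m z)"
    using assms(8-10) by (subst sum.insert) auto
  also have "\<dots> \<le> N"
    unfolding N_def by (intro finite_sum_le_infsum dev) (use assms nonneg in auto)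
  finally have N: "(f x - f y)\<^sup>2 / 2 \<le> N" .
  then have Npos: "0 < N"
    using assms(10) by (smt (verit) half_gt_zero zero_less_power2)
  have g2: "(g z)\<^sup>2 * m z = (1 / N) * ((f z - c)\<^sup>2 * m z)" for z
    using Npos by (simp add: g_def power_divide)
  have energy_g: "energy X b g \<le> ennreal (1 / N)"
    using assms(5) Npos mult_left_mono[of "energy X b f" 1 "ennreal (1 / N)"]
    unfolding g_def energy_affine by (simp add: power_divide)
  have "g \<in> ell2 X m"
    unfolding ell2_def mem_Collect_eq g2 using dev by (rule summable_on_cmult_right)
  moreover have "ell2_inner X m g (\<lambda>_. 1) = 0"
  proof -
    have "ell2_inner X m g (\<lambda>_. 1) = (\<Sum>\<^sub>\<infinity>z\<in>X. (1 / sqrt N) * (f z * m z + (- c) * m z))"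
      unfolding ell2_inner_def g_def by (intro infsum_cong) (simp add: algebra_simps add_divide_distrib[symmetric] diff_divide_distrib[symmetric])
    also have "\<dots> = (1 / sqrt N) * ((\<Sum>\<^sub>\<infinity>z\<in>X. f z * m z) + (- c) * v)"
      unfolding v_def
      by (simp only: infsum_cmult_right' infsum_add[OF fm summable_on_cmult_right[OF summable]])
    also have "\<dots> = 0" using v by (simp add: c_def)
    finally show ?thesis .
  qed
  moreover have "ell2_norm X m g = 1"
  proof -
    have "ell2_inner X m g g = (\<Sum>\<^sub>\<infinity>z\<in>X. (1 / N) * ((f z - c)\<^sup>2 * m z))"
      unfolding ell2_inner_def g2[symmetric] by (simp add: power2_eq_square)
    also have "\<dots> = 1"
      unfolding infsum_cmult_right' N_def[symmetric] using Npos by simp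
    finally show ?thesis by (simp add: ell2_norm_def)
  qed
  moreover have "energy X b g < \<infinity>"
    using energy_g by (rule le_less_trans) simp
  ultimately have "neumann_lambda1 X b m \<le> energy X b g"
    unfolding neumann_lambda1_def by (intro Inf_lower) auto
  also have "\<dots> \<le> ennreal (2 / (f x - f y)\<^sup>2)"
    using energy_g
  proof (rule order_trans, intro ennreal_leI)
    show "1 / N \<le> 2 / (f x - f y)\<^sup>2"
      using N Npos assms(10) by (simp add: divide_simps)
  qed
  finally show ?thesis .
qed

text \<open>
  The measure \<open>m\<close> serves to give every vertex other than \<open>x\<close> and \<open>y\<close> a positive mass of
  negligible total.
\<close>

lemma Inf_neumann_lambda1_vol_le:
  assumes "weighted_graph X b"
    and m: "\<And>x. x \<in> X \<Longrightarrow> 0 < m x" "vol X m < \<infinity>"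
    and f: "energy X b f \<le> 1" "x \<in> X" "y \<in> X" "f y < f x"
  shows "Inf {neumann_lambda1 X b m' * vol X m' |m'. (\<forall>x\<in>X. 0 < m' x) \<and> vol X m' < \<infinity>}
      \<le> ennreal (4 / (f x - f y)\<^sup>2)" (is "?I \<le> _")
proof (rule ennreal_le_epsilon)
  fix \<delta> :: real assume \<delta>: "0 < \<delta>"
  interpret weighted_graph X b by fact
  have m_nonneg: "0 \<le> m z" if "z \<in> X" for z using m(1)[OF that] by simp
  define v where "v = (\<Sum>\<^sub>\<infinity>z\<in>X. m z)"
  have vol: "vol X m = ennreal v" and summable: "m summable_on X"
    using vol_finite[of X m] m_nonneg m(2) by (auto simp: v_def)
  have v: "0 < v" using vol_pos[of X m] nonempty m(1) vol by simp
  define t where "t = f x - f y"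
  have t: "0 < t" using f(4) by (simp add: t_def)
  \<comment> \<open>The choice of \<open>\<epsilon>\<close> makes the error \<open>2 / t\<^sup>2 * (\<epsilon> * v)\<close> equal to \<open>\<delta>\<close>.\<close>
  define \<epsilon> where "\<epsilon> = \<delta> * t\<^sup>2 / (2 * v)"
  have \<epsilon>: "0 < \<epsilon>" using \<delta> t v by (simp add: \<epsilon>_def)
  define m' where "m' = (\<lambda>z. if z \<in> {x, y} then 1 else \<epsilon> * m z)"
  define g where "g = (\<lambda>z. max (f y) (min (f x) (f z)))"
  have m'_pos: "0 < m' z" if "z \<in> X" for z
    using m(1)[OF that] \<epsilon> by (simp add: m'_def)
  have vol': "vol X m' \<le> ennreal (2 + \<epsilon> * v)"
  proof -
    have "vol X m' \<le> (\<Sum>\<^sub>\<infinity>z\<in>X. (if z \<in> {x, y} then 1 else 0) + ennreal \<epsilon> * ennreal (m z))"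
      unfolding vol_def
      by (intro infsum_mono nonneg_summable_on_complete) (use \<epsilon> m_nonneg in \<open>auto simp: m'_def ennreal_mult\<close>)
    also have "\<dots> = (\<Sum>\<^sub>\<infinity>z\<in>X. (if z \<in> {x, y} then 1 else 0)) + ennreal \<epsilon> * vol X m"
      unfolding vol_def infsum_cmult_right_ennreal[symmetric] 
      by (intro infsum_add nonneg_summable_on_complete) auto
    also have "(\<Sum>\<^sub>\<infinity>z\<in>X. (if z \<in> {x, y} then 1 else 0)) = (\<Sum>\<^sub>\<infinity>z\<in>{x, y}. 1 :: ennreal)"
      by (rule infsum_cong_neutral) (use f in auto)
    also have "\<dots> = 2"
      using f(4) by (cases "x = y") auto
    also have "2 + ennreal \<epsilon> * vol X m = ennreal (2 + \<epsilon> * v)"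
      using \<epsilon> v by (simp add: vol ennreal_mult)
    finally show ?thesis .
  qed
  have energy_g: "energy X b g \<le> 1"
    by (rule order_trans[OF energy_contraction f(1)]) (auto simp: g_def nonneg)
  have g_xy: "g x = f x" "g y = f y"
    using f(4) by (auto simp: g_def)
  have "neumann_lambda1 X b m' \<le> ennreal (2 / (g x - g y)\<^sup>2)"
  proof (rule neumann_lambda1_le_test_function[OF nonempty m'_pos _ _ energy_g f(2,3)])
    show "\<bar>g z\<bar> \<le> max \<bar>f x\<bar> \<bar>f y\<bar>" for z
      by (auto simp: g_def)
    show "vol X m' < \<infinity>"
      using vol' by (rule le_less_trans) simp
  qed (use g_xy f(4) in \<open>auto simp: m'_def\<close>)
  then have lambda: "neumann_lambda1 X b m' \<le> ennreal (2 / t\<^sup>2)"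
    by (simp add: g_xy t_def)
  have "?I \<le> neumann_lambda1 X b m' * vol X m'"
    using m'_pos le_less_trans[OF vol' ennreal_less_top] by (intro Inf_lower) auto
  also have "\<dots> \<le> ennreal (2 / t\<^sup>2) * ennreal (2 + \<epsilon> * v)"
    by (intro mult_mono lambda vol') auto
  also have "\<dots> = ennreal (2 / t\<^sup>2 * (2 + \<epsilon> * v))"
    by (intro ennreal_mult'[symmetric]) simp
  also have "2 / t\<^sup>2 * (2 + \<epsilon> * v) = 4 / t\<^sup>2 + \<delta>"
    using t v by (simp add: \<epsilon>_def field_simps)
  also have "ennreal (4 / t\<^sup>2 + \<delta>) = ennreal (4 / (f x - f y)\<^sup>2) + ennreal \<delta>"
    using \<delta> by (simp add: t_def)
  finally show "?I \<le> ennreal (4 / (f x - f y)\<^sup>2) + ennreal \<delta>" .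
qed

theorem corollary5p3:
  fixes X :: "'a set" and b :: "'a \<Rightarrow> 'a \<Rightarrow> real" and m :: "'a \<Rightarrow> real"
  assumes "connected_weighted_graph X b"
    and "\<And>x. x \<in> X \<Longrightarrow> 0 < m x"
    and "vol X m < \<infinity>"
  shows "neumann_lambda1 X b m \<ge> 4 / (diam_r X b * vol X m) \<and>
    Inf {neumann_lambda1 X b m' * vol X m' |m'. (\<forall>x\<in>X. 0 < m' x) \<and> vol X m' < \<infinity>}
      = 4 / diam_r X b"
proof
  interpret connected_weighted_graph X b by fact
  show "4 / (diam_r X b * vol X m) \<le> neumann_lambda1 X b m"
    using nonempty assms(2,3) by (rule neumann_lambda1_ge)
  let ?I = "Inf {neumann_lambda1 X b m' * vol X m' |m'. (\<forall>x\<in>X. 0 < m' x) \<and> vol X m' < \<infinity>}"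
  show "?I = 4 / diam_r X b"
  proof (rule antisym)
    \<comment> \<open>Bounding \<open>diam_r\<close> from above, instead of \<open>?I\<close> by \<open>4 / diam_r\<close> directly, reduces the
      claim to single functions by the definition of a supremum.\<close>
    have "diam_r X b \<le> 4 / ?I"
    proof (rule diam_r_le)
      fix x y f
      assume xyf: "x \<in> X" "y \<in> X" "energy X b f \<le> 1" "f y < f x"
      have "?I \<le> ennreal (4 / (f x - f y)\<^sup>2)"
        using weighted_graph_axioms assms(2,3) xyf(3,1,2,4) by (rule Inf_neumann_lambda1_vol_le)
      then have "?I * ennreal ((f x - f y)\<^sup>2)
          \<le> ennreal (4 / (f x - f y)\<^sup>2) * ennreal ((f x - f y)\<^sup>2)"
        by (intro mult_right_mono) auto
      also have "\<dots> = 4"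
        using xyf(4) by (simp add: ennreal_mult'[symmetric])
      finally show "ennreal ((f x - f y)\<^sup>2) \<le> 4 / ?I"
        by (simp add: le_divide_ennreal_iff)
    qed
    then show "?I \<le> 4 / diam_r X b"
      by (simp add: le_divide_ennreal_iff mult.commute)
    show "4 / diam_r X b \<le> ?I"
    proof (rule Inf_greatest, clarify)
      fix m' assume m': "\<forall>x\<in>X. 0 < m' x" "vol X m' < \<infinity>"
      have "4 / diam_r X b = 4 / (diam_r X b * vol X m') * vol X m'"
        using vol_pos[of X m'] nonempty m'
        by (simp add: ennreal_divide_times ennreal_times_divide divide_mult_eq)
      also have "\<dots> \<le> neumann_lambda1 X b m' * vol X m'"
        by (intro mult_right_mono neumann_lambda1_ge nonempty) (use m' in auto)
      finally show "4 / diam_r X b \<le> neumann_lambda1 X b m' * vol X m'" .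
    qed
  qed
qed

end
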